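(* Let $n\ge 1$ and let $G\le \mathrm{GL}_n(\mathbb C)$ be a finite group. Then $G$ has an abelian normal subgroup $A$ such that $\lvert G/A\rvert\le 25^{n^2}-9^{n^2}$. *)

theory Defs
  imports "HOL-Analysis.Analysis" "HOL-Algebra.Coset"
begin

text \<open>The general linear group GL_n(C), with n = CARD('n), as a HOL-Algebra monoid record.\<close>
definition GL :: "(complex^'n^'n) monoid" where
  "GL = \<lparr>carrier = {M. invertible M}, mult = (\<lambda>A B. A ** B), one = mat 1\<rparr>"

end

theory Submission
  imports Defs
begin

text \<open>
  Averaging over the finite group \<open>G\<close> gives a \<open>G\<close>-invariant norm on \<open>\<complex>\<^sup>n\<close>; its operator norm \<open>N\<close>
  is submultiplicative, satisfies \<open>N 1 = 1\<close> and is invariant under multiplication by \<open>G\<close> on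
  either side. Call \<open>g \<in> G\<close> small if \<open>N (g - 1) < 1/2\<close>. The identity
  \<open>ab - ba = (a - 1)(b - 1) - (b - 1)(a - 1)\<close> shows that the commutator of two small elements
  is strictly closer to \<open>1\<close> than either, and an averaging argument shows that a subgroup all of
  whose elements lie within distance \<open><1\<close> of \<open>1\<close> is trivial; together these imply, by induction
  on the distance to \<open>1\<close>, that small elements commute. The small elements form a
  conjugation-invariant commuting set, so the centre \<open>A\<close> of their centralizer is an abelian normal
  subgroup containing them. Representatives of distinct cosets of \<open>A\<close> are then at \<open>N\<close>-distance
  at least \<open>1/2\<close> on the unit sphere of \<open>N\<close> in the real space \<open>\<complex>\<^sup>n\<^sup>\<times>\<^sup>n \<cong> \<real>\<^sup>2\<^sup>n\<^sup>2\<close>, and comparing the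
  volumes of disjoint balls of radius \<open>1/4\<close> with the shell between radii \<open>3/4\<close> and \<open>5/4\<close>
  bounds their number by \<open>5\<^sup>2\<^sup>n\<^sup>2 - 3\<^sup>2\<^sup>n\<^sup>2 = 25\<^sup>n\<^sup>2 - 9\<^sup>n\<^sup>2\<close>.
\<close>

section \<open>Norms on Euclidean space and sphere packing\<close>

locale abstract_norm =
  fixes N :: "'a::euclidean_space \<Rightarrow> real"
  assumes triangle: "N (x + y) \<le> N x + N y"
    and scaleR: "N (r *\<^sub>R x) = \<bar>r\<bar> * N x"
    and eq_0_imp: "N x = 0 \<Longrightarrow> x = 0"
begin

lemma zero [simp]: "N 0 = 0"
  using scaleR[of 0 0] by simp

lemma minus: "N (- x) = N x"
  using scaleR[of "-1" x] by simp

lemma minus_commute: "N (x - y) = N (y - x)"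
  using minus[of "x - y"] by simp

lemma nonneg: "0 \<le> N x"
  using triangle[of x "- x"] by (simp add: minus)

lemma diff_triangle: "N (x - y) \<le> N x + N y"
  using triangle[of x "- y"] by (simp add: minus)

lemma sum_le: "N (\<Sum>i\<in>A. f i) \<le> (\<Sum>i\<in>A. N (f i))"
proof (induction A rule: infinite_finite_induct)
  case (insert a A)
  then show ?case using triangle[of "f a" "sum f A"] by simp
qed simp_all

lemma le_const_mult_norm: "\<exists>C>0. \<forall>x. N x \<le> C * norm x"
proof -
  define C where "C = (\<Sum>b\<in>Basis. N b) + 1"
  have "C > 0" unfolding C_def using sum_nonneg[of Basis N] nonneg by fastforce
  moreover have "N x \<le> C * norm x" for x
  proof -
    have "N x = N (\<Sum>b\<in>Basis. (x \<bullet> b) *\<^sub>R b)" by (simp add: euclidean_representation)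
    also have "\<dots> \<le> (\<Sum>b\<in>Basis. \<bar>x \<bullet> b\<bar> * N b)"
      using sum_le[of "\<lambda>b. (x \<bullet> b) *\<^sub>R b" Basis] by (simp add: scaleR)
    also have "\<dots> \<le> (\<Sum>b\<in>Basis. norm x * N b)"
      by (intro sum_mono mult_right_mono Basis_le_norm nonneg)
    also have "\<dots> \<le> C * norm x"
      unfolding C_def by (simp add: sum_distrib_left algebra_simps)
    finally show ?thesis .
  qed
  ultimately show ?thesis by blast
qed

lemma continuous_on: "continuous_on UNIV N"
proof -
  obtain C where C: "C > 0" "\<And>x. N x \<le> C * norm x" using le_const_mult_norm by blast
  have "C-lipschitz_on UNIV N"
  proof (rule lipschitz_onI)
    fix x y :: 'a
    have "N x \<le> N (x - y) + N y" "N y \<le> N (y - x) + N x"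
      using triangle[of "x - y" y] triangle[of "y - x" x] by simp_all
    moreover have "N (x - y) \<le> C * dist x y" "N (y - x) \<le> C * dist x y"
      using C(2)[of "x - y"] C(2)[of "y - x"] by (simp_all add: dist_norm norm_minus_commute)
    ultimately show "dist (N x) (N y) \<le> C * dist x y" by (simp add: dist_real_def abs_le_iff)
  qed (use C in simp)
  then show ?thesis by (rule lipschitz_on_continuous_on)
qed

lemma ge_const_mult_norm: "\<exists>c>0. \<forall>x. c * norm x \<le> N x"
proof -
  obtain b :: 'a where "b \<in> Basis" using nonempty_Basis by blast
  then have "sphere (0::'a) 1 \<noteq> {}" by (auto intro!: exI[of _ b])
  then obtain x0 where x0: "x0 \<in> sphere 0 1" "\<And>y. y \<in> sphere 0 1 \<Longrightarrow> N x0 \<le> N y"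
    using continuous_attains_inf[OF compact_sphere _ continuous_on_subset[OF continuous_on]] by blast
  have "x0 \<noteq> 0" using x0(1) by auto
  then have "N x0 > 0" using nonneg[of x0] eq_0_imp[of x0] by fastforce
  moreover have "N x0 * norm x \<le> N x" for x
  proof (cases "x = 0")
    case False
    then have "N x0 \<le> N ((1 / norm x) *\<^sub>R x)" by (intro x0(2)) simp
    also have "\<dots> = N x / norm x" by (simp add: scaleR)
    finally show ?thesis using False by (simp add: field_simps)
  qed simp
  ultimately show ?thesis by blast
qed

definition norm_ball :: "'a \<Rightarrow> real \<Rightarrow> 'a set" where
  "norm_ball x r = {y. N (y - x) < r}"

lemma norm_ball_lmeasurable: "norm_ball x r \<in> lmeasurable"
proof -
  obtain c where c: "c > 0" "\<And>x. c * norm x \<le> N x" using ge_const_mult_norm by blast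
  have "continuous_on UNIV (\<lambda>y. N (y - x))"
    by (rule continuous_on_compose2[OF continuous_on]) (auto intro: continuous_intros)
  then have "open (norm_ball x r)" unfolding norm_ball_def
    by (rule open_Collect_less[OF _ continuous_on_const])
  moreover have "norm_ball x r \<subseteq> cball x (r / c)"
  proof
    fix y assume "y \<in> norm_ball x r"
    then have "c * norm (y - x) < r" using c(2)[of "y - x"] by (simp add: norm_ball_def)
    then show "y \<in> cball x (r / c)" using c(1) by (simp add: field_simps dist_norm norm_minus_commute)
  qed
  then have "bounded (norm_ball x r)" using bounded_cball bounded_subset by blast
  ultimately show ?thesis by (intro lmeasurable_open)
qed

lemma norm_ball_eq_affine_image:
  assumes "r > 0"
  shows "norm_ball x r = (\<lambda>y. r *\<^sub>R y + x) ` norm_ball 0 1"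
proof
  show "norm_ball x r \<subseteq> (\<lambda>y. r *\<^sub>R y + x) ` norm_ball 0 1"
  proof
    fix y assume "y \<in> norm_ball x r"
    then have "(1 / r) *\<^sub>R (y - x) \<in> norm_ball 0 1" using assms by (simp add: norm_ball_def scaleR)
    moreover have "y = r *\<^sub>R ((1 / r) *\<^sub>R (y - x)) + x" using assms by simp
    ultimately show "y \<in> (\<lambda>y. r *\<^sub>R y + x) ` norm_ball 0 1" by blast
  qed
  show "(\<lambda>y. r *\<^sub>R y + x) ` norm_ball 0 1 \<subseteq> norm_ball x r"
    using assms by (auto simp: norm_ball_def scaleR)
qed

lemma measure_norm_ball:
  assumes "r > 0"
  shows "measure lebesgue (norm_ball x r) = r ^ DIM('a) * measure lebesgue (norm_ball 0 1)"
  using measure_lebesgue_affine[of r x "norm_ball 0 1"] norm_ball_eq_affine_image[OF assms, of x] assms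
  by simp

lemma measure_norm_ball_pos: "measure lebesgue (norm_ball 0 1) > 0"
proof -
  obtain C where C: "C > 0" "\<And>x. N x \<le> C * norm x" using le_const_mult_norm by blast
  have sub: "ball 0 (1 / C) \<subseteq> norm_ball (0::'a) 1"
  proof
    fix x :: 'a assume "x \<in> ball 0 (1 / C)"
    then have "C * norm x < 1" using C(1) by (simp add: field_simps)
    then show "x \<in> norm_ball 0 1" using C(2)[of x] by (simp add: norm_ball_def)
  qed
  have "0 < measure lborel (ball (0::'a) (1 / C))"
    using C(1) by (intro content_ball_pos) simp
  also have "\<dots> = measure lebesgue (ball (0::'a) (1 / C))"
    by simp
  also have "\<dots> \<le> measure lebesgue (norm_ball 0 1)"
    by (rule measure_mono_fmeasurable[OF sub]) (use norm_ball_lmeasurable in auto)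
  finally show ?thesis .
qed

text \<open>The \<open>N\<close>-balls of radius \<open>r\<close> around the points of \<open>R\<close> are disjoint and fill
  part of the shell between the spheres of radii \<open>1 - r\<close> and \<open>1 + r\<close>; compare volumes.\<close>
lemma card_sphere_packing:
  assumes "finite R" "0 < r" "r < 1"
    and on_sphere: "\<And>x. x \<in> R \<Longrightarrow> N x = 1"
    and separated: "\<And>x y. x \<in> R \<Longrightarrow> y \<in> R \<Longrightarrow> x \<noteq> y \<Longrightarrow> 2 * r \<le> N (x - y)"
  shows "real (card R) * r ^ DIM('a) \<le> (1 + r) ^ DIM('a) - (1 - r) ^ DIM('a)"
proof -
  define V where "V = measure lebesgue (norm_ball 0 1)"
  have disjoint: "pairwise (\<lambda>x y. disjnt (norm_ball x r) (norm_ball y r)) R"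
  proof (rule pairwiseI)
    fix x y assume xy: "x \<in> R" "y \<in> R" "x \<noteq> y"
    have False if "N (z - x) < r" "N (z - y) < r" for z
      using diff_triangle[of "z - y" "z - x"] separated[OF xy] that by simp
    then show "disjnt (norm_ball x r) (norm_ball y r)"
      by (auto simp: disjnt_iff norm_ball_def)
  qed
  have shell: "(\<Union>x\<in>R. norm_ball x r) \<subseteq> norm_ball 0 (1 + r) - norm_ball 0 (1 - r)"
  proof
    fix z assume "z \<in> (\<Union>x\<in>R. norm_ball x r)"
    then obtain x where x: "x \<in> R" "N (z - x) < r" by (auto simp: norm_ball_def)
    have "N z \<le> N (z - x) + N x" "N x \<le> N (z - x) + N z"
      using triangle[of "z - x" x] diff_triangle[of z "z - x"] by simp_all
    then show "z \<in> norm_ball 0 (1 + r) - norm_ball 0 (1 - r)" using x on_sphere by (simp add: norm_ball_def)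
  qed
  have "real (card R) * (r ^ DIM('a) * V) = (\<Sum>x\<in>R. measure lebesgue (norm_ball x r))"
    using measure_norm_ball[OF assms(2)] by (simp add: V_def)
  also have "\<dots> = measure lebesgue (\<Union>x\<in>R. norm_ball x r)"
    using assms(1) norm_ball_lmeasurable disjoint by (intro measure_UNION'[symmetric]) auto
  also have "\<dots> \<le> measure lebesgue (norm_ball 0 (1 + r) - norm_ball 0 (1 - r))"
    using assms(1) shell norm_ball_lmeasurable
    by (intro measure_mono_fmeasurable) (auto intro: fmeasurable_Diff sets.finite_UN)
  also have "\<dots> = measure lebesgue (norm_ball 0 (1 + r)) - measure lebesgue (norm_ball 0 (1 - r))"
  proof (rule measure_Diff)
    show "emeasure lebesgue (norm_ball 0 (1 + r)) \<noteq> \<infinity>"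
      using fmeasurableD2[OF norm_ball_lmeasurable] by simp
    show "norm_ball 0 (1 - r) \<subseteq> norm_ball 0 (1 + r)" using assms(2) by (auto simp: norm_ball_def)
  qed (auto intro: fmeasurableD[OF norm_ball_lmeasurable])
  also have "\<dots> = ((1 + r) ^ DIM('a) - (1 - r) ^ DIM('a)) * V"
    using measure_norm_ball[of "1 + r"] measure_norm_ball[of "1 - r"] assms(2,3)
    by (simp add: V_def left_diff_distrib)
  finally show ?thesis
    using measure_norm_ball_pos by (simp add: V_def mult.assoc)
qed

end

section \<open>Matrix algebra\<close>

lemma matrix_add_rdistrib: "(A + B) ** C = A ** C + B ** (C :: 'a::semiring_1^'n^'m)"
  by (simp add: matrix_matrix_mult_def vec_eq_iff sum.distrib distrib_right)

lemma matrix_diff_ldistrib: "C ** (A - B) = C ** A - C ** (B :: 'a::ring_1^'n^'m)"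
  by (simp add: matrix_matrix_mult_def vec_eq_iff sum_subtractf right_diff_distrib)

lemma matrix_diff_rdistrib: "(A - B) ** C = A ** C - B ** (C :: 'a::ring_1^'n^'m)"
  by (simp add: matrix_matrix_mult_def vec_eq_iff sum_subtractf left_diff_distrib)

lemma matrix_sum_ldistrib: "B ** (\<Sum>k\<in>K. A k) = (\<Sum>k\<in>K. B ** (A k :: 'a::semiring_1^'n^'m))"
  by (induction K rule: infinite_finite_induct) (simp_all add: matrix_add_ldistrib)

lemma matrix_sum_rdistrib: "(\<Sum>k\<in>K. A k) ** B = (\<Sum>k\<in>K. A k ** (B :: 'a::semiring_1^'n^'m))"
  by (induction K rule: infinite_finite_induct) (simp_all add: matrix_add_rdistrib)

lemma matrix_vector_mult_scaleR_right: "A *v (r *\<^sub>R x) = r *\<^sub>R (A *v x)"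
  for A :: "'a::real_algebra_1^'n^'m"
  by (simp add: matrix_vector_mult_def vec_eq_iff scaleR_sum_right)

lemma matrix_scaleR_vector_assoc: "(r *\<^sub>R A) *v x = r *\<^sub>R (A *v x)"
  for A :: "'a::real_algebra_1^'n^'m"
  by (simp add: matrix_vector_mult_def vec_eq_iff scaleR_sum_right)

lemma matrix_inv_right: "invertible A \<Longrightarrow> A ** matrix_inv A = mat 1"
  and matrix_inv_left: "invertible A \<Longrightarrow> matrix_inv A ** A = mat 1"
  using someI_ex[of "\<lambda>A'. A ** A' = mat 1 \<and> A' ** A = mat 1"]
  by (auto simp: invertible_def matrix_inv_def)

lemma invertible_matrix_inv: "invertible A \<Longrightarrow> invertible (matrix_inv A)"
  using matrix_inv_left matrix_inv_right invertible_def by blast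

section \<open>Centralizers and conjugation\<close>

definition centralizer :: "('a, 'b) monoid_scheme \<Rightarrow> 'a set \<Rightarrow> 'a set" where
  "centralizer G S = {g \<in> carrier G. \<forall>s\<in>S. g \<otimes>\<^bsub>G\<^esub> s = s \<otimes>\<^bsub>G\<^esub> g}"

lemma centralizer_antimono: "S \<subseteq> T \<Longrightarrow> centralizer G T \<subseteq> centralizer G S"
  by (auto simp: centralizer_def)

context group
begin

lemma nat_pow_conj:
  assumes "g \<in> carrier G" "x \<in> carrier G"
  shows "(g \<otimes> x \<otimes> inv g) [^] (k::nat) = g \<otimes> x [^] k \<otimes> inv g"
proof (induction k)
  case (Suc k)
  have "inv g \<otimes> (g \<otimes> (x \<otimes> inv g)) = x \<otimes> inv g" using assms by (simp add: m_assoc[symmetric])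
  with Suc assms show ?case by (simp add: m_assoc)
qed (use assms in simp)

lemma subgroup_centralizer:
  assumes "S \<subseteq> carrier G"
  shows "subgroup (centralizer G S) G"
proof (rule subgroupI)
  have "\<one> \<in> centralizer G S" using assms by (auto simp: centralizer_def)
  then show "centralizer G S \<noteq> {}" by blast
  show "inv g \<in> centralizer G S" if "g \<in> centralizer G S" for g
  proof -
    have g: "g \<in> carrier G" "\<And>s. s \<in> S \<Longrightarrow> g \<otimes> s = s \<otimes> g"
      using that by (auto simp: centralizer_def)
    have cancel: "\<And>x. x \<in> carrier G \<Longrightarrow> inv g \<otimes> (g \<otimes> x) = x"
      using g by (simp add: m_assoc[symmetric])
    have "inv g \<otimes> s = s \<otimes> inv g" if s: "s \<in> S" for s
    proof -
      have sG: "s \<in> carrier G" using s assms by blast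
      have "inv g \<otimes> (g \<otimes> s) \<otimes> inv g = inv g \<otimes> (s \<otimes> g) \<otimes> inv g" using g s by simp
      then show ?thesis using g sG by (simp add: m_assoc cancel)
    qed
    then show ?thesis using g by (simp add: centralizer_def)
  qed
  show "g \<otimes> h \<in> centralizer G S" if gh_cent: "g \<in> centralizer G S" "h \<in> centralizer G S" for g h
  proof -
    have gh: "g \<in> carrier G" "h \<in> carrier G" using gh_cent by (auto simp: centralizer_def)
    have "g \<otimes> h \<otimes> s = s \<otimes> (g \<otimes> h)" if s: "s \<in> S" for s
    proof -
      have sG: "s \<in> carrier G" using s assms by blast
      have "g \<otimes> h \<otimes> s = g \<otimes> (s \<otimes> h)"
        using gh_cent s gh sG by (simp add: m_assoc centralizer_def)
      also have "\<dots> = s \<otimes> g \<otimes> h"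
        using gh_cent s gh sG by (simp add: m_assoc[symmetric] centralizer_def)
      finally show ?thesis using gh sG by (simp add: m_assoc)
    qed
    then show ?thesis using gh by (simp add: centralizer_def)
  qed
qed (auto simp: centralizer_def)

lemma subset_centralizer_centralizer:
  "S \<subseteq> carrier G \<Longrightarrow> S \<subseteq> centralizer G (centralizer G S)"
  by (auto simp: centralizer_def)

lemma normal_centralizer:
  assumes "S \<subseteq> carrier G"
    and conj_closed: "\<And>g s. g \<in> carrier G \<Longrightarrow> s \<in> S \<Longrightarrow> g \<otimes> s \<otimes> inv g \<in> S"
  shows "centralizer G S \<lhd> G"
  unfolding normal_inv_iff
proof (intro conjI ballI subgroup_centralizer[OF assms(1)])
  fix g h assume g: "g \<in> carrier G" and h: "h \<in> centralizer G S"
  have hG: "h \<in> carrier G" using h by (simp add: centralizer_def)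
  have cancel: "\<And>x. x \<in> carrier G \<Longrightarrow> g \<otimes> (inv g \<otimes> x) = x"
    using g by (simp add: m_assoc[symmetric])
  have "g \<otimes> h \<otimes> inv g \<otimes> s = s \<otimes> (g \<otimes> h \<otimes> inv g)" if s: "s \<in> S" for s
  proof -
    have sG: "s \<in> carrier G" using s assms(1) by blast
    have "inv g \<otimes> s \<otimes> g \<in> S" using conj_closed[of "inv g" s] g s by simp
    then have "h \<otimes> (inv g \<otimes> s \<otimes> g) = (inv g \<otimes> s \<otimes> g) \<otimes> h" using h by (simp add: centralizer_def)
    then have "g \<otimes> (h \<otimes> (inv g \<otimes> s \<otimes> g)) \<otimes> inv g = g \<otimes> ((inv g \<otimes> s \<otimes> g) \<otimes> h) \<otimes> inv g"
      by simp
    then show ?thesis using g hG sG by (simp add: m_assoc cancel)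
  qed
  then show "g \<otimes> h \<otimes> inv g \<in> centralizer G S"
    using g h by (simp add: centralizer_def)
qed

lemma normal_centralizer_centralizer:
  assumes "S \<subseteq> carrier G" "\<And>g s. g \<in> carrier G \<Longrightarrow> s \<in> S \<Longrightarrow> g \<otimes> s \<otimes> inv g \<in> S"
  shows "centralizer G (centralizer G S) \<lhd> G"
proof -
  have "centralizer G S \<lhd> G" using assms by (rule normal_centralizer)
  then show ?thesis
    by (intro normal_centralizer) (auto simp: normal_inv_iff centralizer_def)
qed

text \<open>If \<open>S\<close> is commutative, then \<open>S \<subseteq> centralizer G S\<close>, so the double centralizer
  is contained in the single one and therefore commutes with itself.\<close>
lemma centralizer_centralizer_commute:
  assumes "\<And>s t. s \<in> S \<Longrightarrow> t \<in> S \<Longrightarrow> s \<otimes> t = t \<otimes> s" "S \<subseteq> carrier G"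
    and "x \<in> centralizer G (centralizer G S)" "y \<in> centralizer G (centralizer G S)"
  shows "x \<otimes> y = y \<otimes> x"
proof -
  have "S \<subseteq> centralizer G S" using assms(1,2) by (auto simp: centralizer_def)
  then have "centralizer G (centralizer G S) \<subseteq> centralizer G S"
    by (rule centralizer_antimono)
  then show ?thesis using assms(3,4) by (auto simp: centralizer_def)
qed

lemma right_transversal_exists:
  assumes H: "subgroup H G"
  obtains R where "R \<subseteq> carrier G" "bij_betw (\<lambda>x. H #> x) R (rcosets H)"
proof -
  define rep where "rep X = (SOME x. x \<in> X)" for X :: "'a set"
  have rep: "rep X \<in> X" and coset_rep: "H #> rep X = X" if "X \<in> rcosets H" for X
  proof -
    have "\<exists>g\<in>carrier G. X = H #> g" using that unfolding RCOSETS_def by blast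
    then obtain g where g: "g \<in> carrier G" "X = H #> g" by blast
    have "g \<in> H #> g" by (rule rcos_self[OF g(1) H])
    then show rX: "rep X \<in> X" unfolding rep_def g(2) by (rule someI)
    then have "rep X \<in> H #> g" by (simp only: g(2))
    then have "H #> g = H #> rep X" by (rule repr_independence[OF _ g(1) H])
    with g(2) show "H #> rep X = X" by simp
  qed
  have "rep ` (rcosets H) \<subseteq> carrier G"
    using rep subgroup.rcosets_carrier[OF H is_group] by blast
  moreover have "bij_betw (\<lambda>x. H #> x) (rep ` (rcosets H)) (rcosets H)"
    by (rule bij_betw_byWitness[where f'=rep]) (auto simp: coset_rep)
  ultimately show ?thesis using that by blast
qed

end

section \<open>Finite matrix groups and invariant matrix norms\<close>

lemma group_GL: "group GL"
proof (rule groupI)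
  show "x \<otimes>\<^bsub>GL\<^esub> y \<in> carrier GL" if "x \<in> carrier GL" "y \<in> carrier GL" for x y
    using that by (simp add: GL_def invertible_mult)
  show "\<exists>y\<in>carrier GL. y \<otimes>\<^bsub>GL\<^esub> x = \<one>\<^bsub>GL\<^esub>" if "x \<in> carrier GL" for x
    using that by (intro bexI[of _ "matrix_inv x"]) (simp_all add: GL_def matrix_inv_left invertible_matrix_inv)
qed (auto simp: GL_def matrix_mul_assoc invertible_def intro: exI[of _ "mat 1"])

lemma mult_GL [simp]: "x \<otimes>\<^bsub>GL\<^esub> y = x ** y"
  and one_GL [simp]: "\<one>\<^bsub>GL\<^esub> = mat 1"
  by (simp_all add: GL_def)

lemma inv_GL: "invertible A \<Longrightarrow> inv\<^bsub>GL\<^esub> A = matrix_inv A"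
  by (rule group.inv_equality[OF group_GL])
     (simp_all add: GL_def matrix_inv_left invertible_matrix_inv)

locale finite_matrix_group =
  fixes G :: "(complex^'n^'n) set"
  assumes subgroup_GL: "subgroup G GL"
    and finite_G: "finite G"
begin

abbreviation grp :: "(complex^'n^'n) monoid" where
  "grp \<equiv> GL\<lparr>carrier := G\<rparr>"

lemma group_grp: "group grp"
  by (rule subgroup.subgroup_is_group[OF subgroup_GL group_GL])

lemma invertible_mem: "g \<in> G \<Longrightarrow> invertible g"
  using subgroup.subset[OF subgroup_GL] by (auto simp: GL_def)

lemma mat_1_mem [simp]: "mat 1 \<in> G"
  using subgroup.one_closed[OF subgroup_GL] by (simp add: GL_def)

lemma mult_mem [simp]: "x \<in> G \<Longrightarrow> y \<in> G \<Longrightarrow> x ** y \<in> G"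
  using subgroup.m_closed[OF subgroup_GL] by (simp add: GL_def)

lemma matrix_inv_mem [simp]:
  assumes "g \<in> G"
  shows "matrix_inv g \<in> G"
  using subgroup.m_inv_closed[OF subgroup_GL assms] inv_GL[OF invertible_mem[OF assms]] by simp

lemma inv_grp [simp]: "g \<in> G \<Longrightarrow> inv\<^bsub>grp\<^esub> g = matrix_inv g"
  by (rule group.inv_equality[OF group_grp]) (simp_all add: matrix_inv_left invertible_mem)

lemma matrix_inv_cancel [simp]:
  "g \<in> G \<Longrightarrow> g ** matrix_inv g = mat 1"
  "g \<in> G \<Longrightarrow> matrix_inv g ** g = mat 1"
  "g \<in> G \<Longrightarrow> X ** g ** matrix_inv g = X"
  "g \<in> G \<Longrightarrow> X ** matrix_inv g ** g = X"
  by (simp_all add: matrix_inv_left matrix_inv_right invertible_mem flip: matrix_mul_assoc)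

end

locale invariant_matrix_norm = finite_matrix_group G + abstract_norm N
  for G :: "(complex^'n^'n) set" and N :: "complex^'n^'n \<Rightarrow> real" +
  assumes mult_le: "N (X ** Y) \<le> N X * N Y"
    and mat_1: "N (mat 1) = 1"
    and mult_left_invariant: "g \<in> G \<Longrightarrow> N (g ** X) = N X"
    and mult_right_invariant: "g \<in> G \<Longrightarrow> N (X ** g) = N X"

context finite_matrix_group
begin

definition vnorm :: "complex^'n \<Rightarrow> real" where
  "vnorm x = (\<Sum>g\<in>G. norm (g *v x))"

lemma vnorm_mult:
  assumes "g \<in> G"
  shows "vnorm (g *v x) = vnorm x"
proof -
  have "vnorm (g *v x) = (\<Sum>h\<in>G. norm ((h ** g) *v x))"
    by (simp add: vnorm_def matrix_vector_mul_assoc)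
  also have "\<dots> = vnorm x"
    unfolding vnorm_def
    by (rule sum.reindex_bij_witness[of _ "\<lambda>k. k ** matrix_inv g" "\<lambda>h. h ** g"])
       (use assms in simp_all)
  finally show ?thesis .
qed

lemma norm_le_vnorm: "norm x \<le> vnorm x"
  using member_le_sum[OF mat_1_mem, of "\<lambda>g. norm (g *v x)"] finite_G by (simp add: vnorm_def)

lemma vnorm_triangle: "vnorm (x + y) \<le> vnorm x + vnorm y"
  unfolding vnorm_def sum.distrib[symmetric]
  by (rule sum_mono) (simp add: matrix_vector_right_distrib norm_triangle_ineq)

lemma vnorm_scaleR: "vnorm (r *\<^sub>R x) = \<bar>r\<bar> * vnorm x"
  by (simp add: vnorm_def sum_distrib_left matrix_vector_mult_scaleR_right)

lemma vnorm_0 [simp]: "vnorm 0 = 0"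
  by (simp add: vnorm_def)

lemma vnorm_le_const_mult_norm: "vnorm x \<le> (\<Sum>g\<in>G. onorm ((*v) g)) * norm x"
  unfolding vnorm_def sum_distrib_right by (intro sum_mono onorm) simp

definition mnorm :: "complex^'n^'n \<Rightarrow> real" where
  "mnorm X = (SUP x\<in>{x. vnorm x \<le> 1}. vnorm (X *v x))"

lemma bdd_above_mnorm: "bdd_above ((\<lambda>x. vnorm (X *v x)) ` {x. vnorm x \<le> 1})"
proof
  fix y assume "y \<in> (\<lambda>x. vnorm (X *v x)) ` {x. vnorm x \<le> 1}"
  then obtain x where x: "vnorm x \<le> 1" "y = vnorm (X *v x)" by blast
  define K where "K = (\<Sum>g\<in>G. onorm ((*v) g))"
  have K: "K \<ge> 0" unfolding K_def by (intro sum_nonneg onorm_pos_le) simp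
  have "y \<le> K * norm (X *v x)" using vnorm_le_const_mult_norm x(2) by (simp add: K_def)
  also have "\<dots> \<le> K * (onorm ((*v) X) * norm x)" using K by (intro mult_left_mono onorm) simp_all
  also have "\<dots> \<le> K * (onorm ((*v) X) * 1)"
    using K x(1) norm_le_vnorm[of x] by (intro mult_left_mono onorm_pos_le) simp_all
  finally show "y \<le> K * onorm ((*v) X)" by simp
qed

lemma vnorm_mult_le: "vnorm (X *v x) \<le> mnorm X * vnorm x"
proof (cases "x = 0")
  case False
  then have "0 < norm x" by simp
  then have pos: "vnorm x > 0" using norm_le_vnorm[of x] by linarith
  have "vnorm (X *v ((1 / vnorm x) *\<^sub>R x)) \<le> mnorm X" unfolding mnorm_def
    by (rule cSup_upper[OF _ bdd_above_mnorm]) (use pos in \<open>simp add: vnorm_scaleR\<close>)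
  then show ?thesis using pos by (simp add: matrix_vector_mult_scaleR_right vnorm_scaleR field_simps)
qed simp

lemma mnorm_le:
  assumes "0 \<le> c" "\<And>x. vnorm (X *v x) \<le> c * vnorm x"
  shows "mnorm X \<le> c"
  unfolding mnorm_def
proof (rule cSup_least)
  fix y assume "y \<in> (\<lambda>x. vnorm (X *v x)) ` {x. vnorm x \<le> 1}"
  then obtain x where x: "vnorm x \<le> 1" "y = vnorm (X *v x)" by blast
  have "y \<le> c * vnorm x" using assms(2) x(2) by simp
  also have "\<dots> \<le> c" using mult_left_le[OF x(1) assms(1)] by (simp add: mult.commute)
  finally show "y \<le> c" .
qed (auto intro!: exI[of _ 0])

lemma mnorm_nonneg: "0 \<le> mnorm X"
proof -
  have "vnorm (X *v 0) \<le> mnorm X" unfolding mnorm_def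
    by (rule cSup_upper[OF image_eqI[where x=0] bdd_above_mnorm]) simp_all
  then show ?thesis by simp
qed

lemma mnorm_triangle: "mnorm (X + Y) \<le> mnorm X + mnorm Y"
proof (rule mnorm_le)
  show "0 \<le> mnorm X + mnorm Y" using mnorm_nonneg by (simp add: add_nonneg_nonneg)
  fix x
  have "vnorm ((X + Y) *v x) \<le> vnorm (X *v x) + vnorm (Y *v x)"
    by (simp add: matrix_vector_mult_add_rdistrib vnorm_triangle)
  also have "\<dots> \<le> mnorm X * vnorm x + mnorm Y * vnorm x" by (intro add_mono vnorm_mult_le)
  finally show "vnorm ((X + Y) *v x) \<le> (mnorm X + mnorm Y) * vnorm x" by (simp add: algebra_simps)
qed

lemma mnorm_scaleR_le: "mnorm (r *\<^sub>R X) \<le> \<bar>r\<bar> * mnorm X"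
proof (rule mnorm_le)
  show "0 \<le> \<bar>r\<bar> * mnorm X" using mnorm_nonneg by simp
  fix x
  have "vnorm ((r *\<^sub>R X) *v x) = \<bar>r\<bar> * vnorm (X *v x)"
    by (simp add: matrix_scaleR_vector_assoc vnorm_scaleR)
  also have "\<dots> \<le> \<bar>r\<bar> * (mnorm X * vnorm x)" using vnorm_mult_le by (intro mult_left_mono) auto
  finally show "vnorm ((r *\<^sub>R X) *v x) \<le> \<bar>r\<bar> * mnorm X * vnorm x" by (simp add: algebra_simps)
qed

lemma mnorm_scaleR: "mnorm (r *\<^sub>R X) = \<bar>r\<bar> * mnorm X"
proof (cases "r = 0")
  case True
  then show ?thesis using mnorm_scaleR_le[of 0 X] mnorm_nonneg[of 0] by simp
next
  case False
  have "mnorm X \<le> \<bar>1 / r\<bar> * mnorm (r *\<^sub>R X)"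
    using mnorm_scaleR_le[of "1 / r" "r *\<^sub>R X"] False by simp
  then show ?thesis using mnorm_scaleR_le[of r X] False by (simp add: field_simps)
qed

lemma mnorm_eq_0_imp:
  assumes "mnorm X = 0"
  shows "X = 0"
proof -
  have "X *v x = 0" for x
  proof -
    have "vnorm (X *v x) \<le> 0" using vnorm_mult_le[of X x] assms by simp
    then show ?thesis using norm_le_vnorm[of "X *v x"] by (metis norm_le_zero_iff order_trans)
  qed
  then show ?thesis by (simp add: matrix_eq)
qed

lemma mnorm_mult_le: "mnorm (X ** Y) \<le> mnorm X * mnorm Y"
proof (rule mnorm_le)
  show "0 \<le> mnorm X * mnorm Y" using mnorm_nonneg by simp
  fix x
  have "vnorm ((X ** Y) *v x) \<le> mnorm X * vnorm (Y *v x)"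
    using vnorm_mult_le by (simp flip: matrix_vector_mul_assoc)
  also have "\<dots> \<le> mnorm X * (mnorm Y * vnorm x)"
    using vnorm_mult_le mnorm_nonneg by (intro mult_left_mono)
  finally show "vnorm ((X ** Y) *v x) \<le> mnorm X * mnorm Y * vnorm x" by (simp add: algebra_simps)
qed

lemma mnorm_mat_1: "mnorm (mat 1) = 1"
proof (rule antisym)
  show "mnorm (mat 1) \<le> 1" by (rule mnorm_le) simp_all
  define x :: "complex^'n" where "x = axis undefined 1"
  have "0 < norm x" by (simp add: x_def)
  then have "0 < vnorm x" using norm_le_vnorm[of x] by linarith
  then show "1 \<le> mnorm (mat 1)" using vnorm_mult_le[of "mat 1" x] by simp
qed

lemma mnorm_mult_left: "g \<in> G \<Longrightarrow> mnorm (g ** X) = mnorm X"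
  by (simp add: mnorm_def vnorm_mult flip: matrix_vector_mul_assoc)

lemma mnorm_mult_right_le: "g \<in> G \<Longrightarrow> mnorm (X ** g) \<le> mnorm X"
  by (rule mnorm_le[OF mnorm_nonneg])
     (metis vnorm_mult_le vnorm_mult matrix_vector_mul_assoc)

lemma mnorm_mult_right: "g \<in> G \<Longrightarrow> mnorm (X ** g) = mnorm X"
  using mnorm_mult_right_le[of g X] mnorm_mult_right_le[of "matrix_inv g" "X ** g"]
  by simp

lemma invariant_matrix_norm_mnorm: "invariant_matrix_norm G mnorm"
  by unfold_locales
    (simp_all add: mnorm_triangle mnorm_scaleR mnorm_eq_0_imp mnorm_mult_le mnorm_mat_1
      mnorm_mult_left mnorm_mult_right)

end

section \<open>Small elements\<close>

context invariant_matrix_norm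
begin

lemma norm_mem_eq_1: "g \<in> G \<Longrightarrow> N g = 1"
  using mult_right_invariant[of g "mat 1"] mat_1 by simp

lemma norm_conj: "g \<in> G \<Longrightarrow> N (g ** X ** matrix_inv g) = N X"
  by (simp add: mult_left_invariant mult_right_invariant)

lemma commutator_le: "N (A ** B - B ** A) \<le> 2 * N (A - mat 1) * N (B - mat 1)"
proof -
  have "A ** B - B ** A = (A - mat 1) ** (B - mat 1) - (B - mat 1) ** (A - mat 1)"
    by (simp add: matrix_diff_ldistrib matrix_diff_rdistrib)
  then have "N (A ** B - B ** A) \<le> N ((A - mat 1) ** (B - mat 1)) + N ((B - mat 1) ** (A - mat 1))"
    using diff_triangle by simp
  also have "\<dots> \<le> N (A - mat 1) * N (B - mat 1) + N (B - mat 1) * N (A - mat 1)"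
    by (intro add_mono mult_le)
  finally show ?thesis by simp
qed

lemma commutator_le_invariant:
  assumes h: "h \<in> G"
  shows "N (A ** h - h ** A) \<le> 2 * N (A - mat 1)"
proof -
  have "A ** h - h ** A = (A - mat 1) ** h - h ** (A - mat 1)"
    by (simp add: matrix_diff_ldistrib matrix_diff_rdistrib)
  then show ?thesis
    using diff_triangle[of "(A - mat 1) ** h" "h ** (A - mat 1)"] h
    by (simp add: mult_left_invariant mult_right_invariant)
qed

text \<open>If \<open>P = mat 1 - Q\<close> is idempotent then \<open>N P \<le> N P ^ 2\<close>, so \<open>N P\<close> is \<open>0\<close> or at least \<open>1\<close>.\<close>
lemma idempotent_eq_mat_1:
  assumes "Q ** Q = Q" "N (Q - mat 1) < 1"
  shows "Q = mat 1"
proof -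
  have "(mat 1 - Q) ** (mat 1 - Q) = mat 1 - Q"
    using assms(1) by (simp add: matrix_diff_ldistrib matrix_diff_rdistrib)
  then have "N (mat 1 - Q) \<le> N (mat 1 - Q) * N (mat 1 - Q)" by (metis mult_le)
  then have "N (mat 1 - Q) * (1 - N (mat 1 - Q)) \<le> 0" by (simp add: algebra_simps)
  moreover have "N (mat 1 - Q) < 1" using assms(2) minus_commute by simp
  ultimately have "N (mat 1 - Q) = 0" using nonneg[of "mat 1 - Q"] by (simp add: mult_le_0_iff)
  then show ?thesis using eq_0_imp[of "mat 1 - Q"] by simp
qed

text \<open>The average \<open>Q\<close> of the elements of \<open>K\<close> satisfies \<open>k ** Q = Q\<close> for \<open>k \<in> K\<close>, so it is an
  idempotent within \<open>c\<close> of the identity.\<close>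
lemma submonoid_near_mat_1_trivial:
  assumes "K \<subseteq> G" and mult_closed: "\<And>x y. x \<in> K \<Longrightarrow> y \<in> K \<Longrightarrow> x ** y \<in> K"
    and near: "\<And>x. x \<in> K \<Longrightarrow> N (x - mat 1) \<le> c" and "c < 1" and "k \<in> K"
  shows "k = mat 1"
proof -
  have fin: "finite K" using assms(1) finite_G finite_subset by blast
  then have card: "real (card K) > 0" using assms(5) card_gt_0_iff by fastforce
  define Q where "Q = (1 / real (card K)) *\<^sub>R (\<Sum>x\<in>K. x)"
  have absorb: "x ** Q = Q" if x: "x \<in> K" for x
  proof -
    have xG: "x \<in> G" using x assms(1) by blast
    have "inj_on ((**) x) K"
      by (rule inj_onI) (metis xG matrix_inv_cancel(2) matrix_mul_assoc matrix_mul_lid)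
    moreover have "(**) x ` K = K"
      using x mult_closed \<open>inj_on ((**) x) K\<close> fin by (intro endo_inj_surj) auto
    ultimately have sum_eq: "(\<Sum>y\<in>K. x ** y) = (\<Sum>y\<in>K. y)"
      using sum.reindex[of "(**) x" K id] by simp
    have "x ** Q = (1 / real (card K)) *\<^sub>R (\<Sum>y\<in>K. x ** y)"
      by (simp add: Q_def matrix_sum_ldistrib scaleR_sum_right matrix_scalar_ac
          flip: scalar_matrix_assoc)
    then show ?thesis by (simp only: sum_eq Q_def)
  qed
  have "Q ** Q = (1 / real (card K)) *\<^sub>R (\<Sum>x\<in>K. x ** Q)"
    by (simp add: Q_def matrix_sum_rdistrib flip: scalar_matrix_assoc)
  also have "\<dots> = Q" using card by (simp add: absorb sum_constant_scaleR del: sum_constant)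
  finally have "Q ** Q = Q" .
  moreover have "N (Q - mat 1) < 1"
  proof -
    have "Q - mat 1 = (1 / real (card K)) *\<^sub>R (\<Sum>x\<in>K. x - mat 1)"
      using card by (simp add: Q_def sum_subtractf scaleR_diff_right sum_constant_scaleR del: sum_constant)
    then have "N (Q - mat 1) \<le> (1 / real (card K)) * (\<Sum>x\<in>K. N (x - mat 1))"
      using sum_le[of "\<lambda>x. x - mat 1" K] by (simp add: scaleR divide_right_mono)
    also have "\<dots> \<le> (1 / real (card K)) * (\<Sum>x\<in>K. c)"
      using near by (intro mult_left_mono sum_mono) auto
    also have "\<dots> = c" using card by simp
    finally show ?thesis using \<open>c < 1\<close> by simp
  qed
  ultimately have "Q = mat 1" by (rule idempotent_eq_mat_1)
  then show ?thesis using absorb[OF assms(5)] by simp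
qed

text \<open>With \<open>u = a\<inverse> (b a b\<inverse>)\<close>, commutation gives \<open>u\<^sup>k = a\<^sup>-\<^sup>k b a\<^sup>k b\<inverse>\<close>, so every power of \<open>u\<close>
  is within \<open>2 N (b - 1) < 1\<close> of the identity.\<close>
lemma commute_if_commute_conj:
  assumes a: "a \<in> G" and b: "b \<in> G" and small_b: "N (b - mat 1) < 1/2"
    and comm: "a ** (b ** a ** matrix_inv b) = (b ** a ** matrix_inv b) ** a"
  shows "a ** b = b ** a"
proof -
  interpret grp: group grp by (rule group_grp)
  define a' where "a' = b ** a ** matrix_inv b"
  define u where "u = matrix_inv a ** a'"
  have a': "a' \<in> G" and u: "u \<in> G" using a b by (simp_all add: a'_def u_def)
  have "a \<in> centralizer grp {a'}" using a comm by (simp add: centralizer_def a'_def)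
  then have "inv\<^bsub>grp\<^esub> a \<in> centralizer grp {a'}"
    using a' by (intro subgroup.m_inv_closed[OF grp.subgroup_centralizer]) simp_all
  then have "matrix_inv a \<in> centralizer grp {a'}" using a by simp
  then have inv_a_comm: "matrix_inv a ** a' = a' ** matrix_inv a" by (simp add: centralizer_def)
  have bound: "N (u [^]\<^bsub>grp\<^esub> k - mat 1) \<le> 2 * N (b - mat 1)" for k :: nat
  proof -
    define p where "p = a [^]\<^bsub>grp\<^esub> k"
    have p: "p \<in> G" using grp.nat_pow_closed a by (simp add: p_def)
    have "u [^]\<^bsub>grp\<^esub> k = matrix_inv p ** (b ** p ** matrix_inv b)"
      using grp.pow_mult_distrib[of "matrix_inv a" a' k] grp.nat_pow_inv[of a k]
        grp.nat_pow_conj[of b a k] inv_a_comm a b a' p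
      by (simp add: u_def a'_def flip: p_def)
    then have "u [^]\<^bsub>grp\<^esub> k - mat 1 = matrix_inv p ** ((b ** p - p ** b) ** matrix_inv b)"
      using p b by (simp add: matrix_diff_ldistrib matrix_diff_rdistrib matrix_mul_assoc)
    then have "N (u [^]\<^bsub>grp\<^esub> k - mat 1) = N (b ** p - p ** b)"
      using p b by (simp add: mult_left_invariant mult_right_invariant)
    also have "\<dots> \<le> 2 * N (b - mat 1)" using p by (rule commutator_le_invariant)
    finally show ?thesis .
  qed
  have "u [^]\<^bsub>grp\<^esub> (1::nat) = mat 1"
  proof (rule submonoid_near_mat_1_trivial[where K="range (\<lambda>k. u [^]\<^bsub>grp\<^esub> (k::nat))"])
    show "range (\<lambda>k. u [^]\<^bsub>grp\<^esub> (k::nat)) \<subseteq> G" using grp.nat_pow_closed u by auto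
    show "x ** y \<in> range (\<lambda>k. u [^]\<^bsub>grp\<^esub> (k::nat))"
      if "x \<in> range (\<lambda>k. u [^]\<^bsub>grp\<^esub> (k::nat))" "y \<in> range (\<lambda>k. u [^]\<^bsub>grp\<^esub> (k::nat))" for x y
      using that grp.nat_pow_mult[of u] u by auto
    show "2 * N (b - mat 1) < 1" using small_b by simp
    show "u [^]\<^bsub>grp\<^esub> (1::nat) \<in> range (\<lambda>k. u [^]\<^bsub>grp\<^esub> (k::nat))" by (rule rangeI)
  qed (use bound in auto)
  then have "a ** (matrix_inv a ** a') = a" using u by (simp add: u_def)
  then have "a' = a" using a by (simp add: matrix_mul_assoc)
  then have "b ** a ** matrix_inv b ** b = a ** b" by (simp add: a'_def)
  then show ?thesis using b by simp
qed

definition small :: "(complex^'n^'n) set" where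
  "small = {g \<in> G. N (g - mat 1) < 1/2}"

lemma small_subset: "small \<subseteq> G"
  by (auto simp: small_def)

lemma conj_mem_small: "g \<in> G \<Longrightarrow> s \<in> small \<Longrightarrow> g ** s ** matrix_inv g \<in> small"
  using norm_conj[of g "s - mat 1"]
  by (simp add: small_def matrix_diff_ldistrib matrix_diff_rdistrib)

lemma mult_inv_mem_small:
  assumes "x \<in> G" "y \<in> G" "N (x - y) < 1/2"
  shows "x ** matrix_inv y \<in> small"
proof -
  have "x ** matrix_inv y - mat 1 = (x - y) ** matrix_inv y"
    using assms(2) by (simp add: matrix_diff_rdistrib)
  then show ?thesis using assms by (simp add: small_def mult_right_invariant)
qed

text \<open>Induction on how many elements of \<open>G\<close> are closer to \<open>1\<close> than \<open>b\<close>: the commutator \<open>c\<close> of \<open>a\<close>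
  and \<open>b\<close> is strictly closer, so it commutes with \<open>a\<close>; hence so does \<open>b a b\<inverse> = (a\<inverse> c)\<inverse>\<close>.\<close>
lemma small_commute:
  assumes "a \<in> small" "b \<in> small"
  shows "a ** b = b ** a"
  using assms(2)
proof (induction b rule: measure_induct_rule[where f="\<lambda>b. card {x\<in>G. N (x - mat 1) < N (b - mat 1)}"])
  case (less b)
  interpret grp: group grp by (rule group_grp)
  have a: "a \<in> G" "N (a - mat 1) < 1/2" and b: "b \<in> G" "N (b - mat 1) < 1/2"
    using assms(1) less.prems by (auto simp: small_def)
  show ?case
  proof (rule ccontr)
    assume noncomm: "a ** b \<noteq> b ** a"
    then have "N (b - mat 1) > 0" using nonneg[of "b - mat 1"] eq_0_imp[of "b - mat 1"] by force
    define c where "c = a ** b ** matrix_inv a ** matrix_inv b"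
    have c: "c \<in> G" using a b by (simp add: c_def)
    have "c - mat 1 = (a ** b - b ** a) ** (matrix_inv a ** matrix_inv b)"
      using a b by (simp add: c_def matrix_diff_rdistrib matrix_mul_assoc)
    then have "N (c - mat 1) = N (a ** b - b ** a)" using a b by (simp add: mult_right_invariant)
    also have "\<dots> \<le> 2 * N (a - mat 1) * N (b - mat 1)" by (rule commutator_le)
    also have "\<dots> < N (b - mat 1)" using a(2) \<open>N (b - mat 1) > 0\<close> by simp
    finally have closer: "N (c - mat 1) < N (b - mat 1)" .
    have "{x\<in>G. N (x - mat 1) < N (c - mat 1)} \<subset> {x\<in>G. N (x - mat 1) < N (b - mat 1)}"
      using closer c by auto
    then have "a ** c = c ** a"
      using less.IH c closer b(2) finite_G by (simp add: psubset_card_mono small_def)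
    then have "c \<in> centralizer grp {a}" using c by (simp add: centralizer_def)
    moreover have sub: "subgroup (centralizer grp {a}) grp"
      using a by (intro grp.subgroup_centralizer) simp
    moreover have "a \<in> centralizer grp {a}" using a by (simp add: centralizer_def)
    ultimately have "inv\<^bsub>grp\<^esub> (inv\<^bsub>grp\<^esub> a \<otimes>\<^bsub>grp\<^esub> c) \<in> centralizer grp {a}"
      by (intro subgroup.m_inv_closed[OF sub] subgroup.m_closed[OF sub])
    moreover have "inv\<^bsub>grp\<^esub> (inv\<^bsub>grp\<^esub> a \<otimes>\<^bsub>grp\<^esub> c) = b ** a ** matrix_inv b"
      using a b c by (intro grp.inv_equality) (simp_all add: c_def matrix_mul_assoc)
    ultimately have "a ** (b ** a ** matrix_inv b) = (b ** a ** matrix_inv b) ** a"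
      by (simp add: centralizer_def)
    then show False using commute_if_commute_conj a b noncomm by blast
  qed
qed

text \<open>Distinct elements of a right transversal of \<open>A\<close> lie at distance at least \<open>1/2\<close> on the unit
  sphere of \<open>N\<close>, so the sphere packing bound applies with radius \<open>1/4\<close> in real dimension \<open>2 n\<^sup>2\<close>.\<close>
lemma card_rcosets_le:
  assumes A: "subgroup A grp" and small_A: "small \<subseteq> A"
  shows "card (rcosets\<^bsub>grp\<^esub> A) \<le> 25 ^ (CARD('n)^2) - 9 ^ (CARD('n)^2)"
proof -
  interpret grp: group grp by (rule group_grp)
  obtain R where R: "R \<subseteq> carrier grp" "bij_betw (\<lambda>x. A #>\<^bsub>grp\<^esub> x) R (rcosets\<^bsub>grp\<^esub> A)"
    by (rule grp.right_transversal_exists[OF A])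
  have separated: "1/2 \<le> N (x - y)" if xy: "x \<in> R" "y \<in> R" "x \<noteq> y" for x y
  proof (rule ccontr)
    assume "\<not> 1/2 \<le> N (x - y)"
    moreover have "x \<in> G" "y \<in> G" using R(1) xy by auto
    ultimately have "x ** matrix_inv y \<in> A" using mult_inv_mem_small[of x y] small_A by auto
    then have "x \<in> A #>\<^bsub>grp\<^esub> y"
      using subgroup.rcos_module_rev[OF A group_grp, of y x] \<open>x \<in> G\<close> \<open>y \<in> G\<close> by simp
    then have "A #>\<^bsub>grp\<^esub> y = A #>\<^bsub>grp\<^esub> x"
      using \<open>y \<in> G\<close> by (intro grp.repr_independence[OF _ _ A]) simp_all
    then show False using bij_betw_imp_inj_on[OF R(2)] xy by (auto dest: inj_onD)
  qed
  have fin: "finite R" using R(1) finite_G finite_subset by auto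
  let ?d = "DIM(complex^'n^'n)"
  have "real (card R) * (1/4) ^ ?d \<le> (1 + 1/4) ^ ?d - (1 - 1/4) ^ ?d"
    using R(1) separated norm_mem_eq_1 by (intro card_sphere_packing[OF fin]) auto
  then have "real (card (rcosets\<^bsub>grp\<^esub> A)) \<le> 5 ^ ?d - 3 ^ ?d"
    using bij_betw_same_card[OF R(2)] by (simp add: field_simps power_divide)
  also have "?d = 2 * CARD('n)^2" by (simp add: power2_eq_square)
  finally have "real (card (rcosets\<^bsub>grp\<^esub> A)) \<le> 25 ^ (CARD('n)^2) - 9 ^ (CARD('n)^2)"
    by (simp add: power_mult)
  moreover have "(9::nat) ^ (CARD('n)^2) \<le> 25 ^ (CARD('n)^2)" by (rule power_mono) auto
  ultimately have "real (card (rcosets\<^bsub>grp\<^esub> A)) \<le> real (25 ^ (CARD('n)^2) - 9 ^ (CARD('n)^2))"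
    by (simp add: of_nat_diff)
  then show ?thesis by (simp only: of_nat_le_iff)
qed

end

theorem mainTheorem2:
  fixes G :: "(complex^'n^'n) set"
  assumes "subgroup G (GL :: (complex^'n^'n) monoid)"
    and "finite G"
  shows "\<exists>A. normal A ((GL :: (complex^'n^'n) monoid)\<lparr>carrier := G\<rparr>)
             \<and> (\<forall>x\<in>A. \<forall>y\<in>A. x ** y = y ** x)
             \<and> card (rcosets\<^bsub>(GL :: (complex^'n^'n) monoid)\<lparr>carrier := G\<rparr>\<^esub> A)
                 \<le> 25 ^ (CARD('n)^2) - 9 ^ (CARD('n)^2)"
proof -
  interpret finite_matrix_group G using assms by (rule finite_matrix_group.intro)
  interpret invariant_matrix_norm G mnorm by (rule invariant_matrix_norm_mnorm)
  interpret grp: group grp by (rule group_grp)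
  define A where "A = centralizer grp (centralizer grp small)"
  have small: "small \<subseteq> carrier grp" using small_subset by simp
  have "A \<lhd> grp"
    unfolding A_def using small conj_mem_small by (intro grp.normal_centralizer_centralizer) auto
  moreover have "\<forall>x\<in>A. \<forall>y\<in>A. x ** y = y ** x"
    using grp.centralizer_centralizer_commute[OF _ small] small_commute by (auto simp: A_def)
  moreover have "card (rcosets\<^bsub>grp\<^esub> A) \<le> 25 ^ (CARD('n)^2) - 9 ^ (CARD('n)^2)"
    using \<open>A \<lhd> grp\<close> grp.subset_centralizer_centralizer[OF small]
    by (intro card_rcosets_le) (simp_all add: normal_imp_subgroup A_def)
  ultimately show ?thesis by blast
qed

end
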